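(* For a $2 \times 2$ storage area $W$ whose open side is its bottom (front) row, relocations may be necessary: there exist a number of loads $n \le 4$ and an arrival sequence $A$ (a permutation of $\{1,\dots,n\}$) such that, with departure sequence $D=(1,\dots,n)$, there is no sequence of actions without relocations that first stores all loads in the order $A$ and then retrieves them in the order $D$.
   Context: Storage area: a rectangular grid $W$ with $r$ rows and $c$ columns (here $r=c=2$); the bottom row (front row) is the only side through which loads enter and leave. There are $n \le rc$ loads with distinct labels $1,\dots,n$, each occupying exactly one cell; no two loads share a cell. A load moves only along paths of horizontally/vertically adjacent cells (moves up, down, left, right) that are currently empty (apart from the load's own starting cell). Actions: (Storage) an arriving load is placed in an empty cell $v$ via a path from any cell of the front row to $v$. (Retrieval) a load is removed via a path from its current cell to any cell of the front row. (Relocation) a load is moved inside $W$ from its current cell to an empty cell $v$ via a path, where $v$ and the original cell must be accessible from the front row. Loads arrive one at a time in the order $A=(a_1,\dots,a_n)$, each being stored before the next arrives; after all are stored, they are retrieved in the order of the departure sequence $D$, fixed to be $(1,\dots,n)$ by relabeling. Both $A$ and $D$ are known in advance. *)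

theory Defs
  imports Main
begin

text \<open>Cells are pairs (row, column). Row 0 is the front row, i.e. the open side of the storage area.\<close>

type_synonym cell = "nat \<times> nat"
type_synonym load = nat
type_synonym config = "cell \<Rightarrow> load option"

definition grid :: "nat \<Rightarrow> nat \<Rightarrow> cell set" where
  "grid r c = {..<r} \<times> {..<c}"

definition front_row :: "nat \<Rightarrow> nat \<Rightarrow> cell set" where
  "front_row r c = {v \<in> grid r c. fst v = 0}"

definition adjacent :: "cell \<Rightarrow> cell \<Rightarrow> bool" where
  "adjacent u v \<longleftrightarrow>
     fst u = fst v \<and> (snd v = Suc (snd u) \<or> snd u = Suc (snd v)) \<or>
     snd u = snd v \<and> (fst v = Suc (fst u) \<or> fst u = Suc (fst v))"

definition empty_cells :: "nat \<Rightarrow> nat \<Rightarrow> config \<Rightarrow> cell set" where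
  "empty_cells r c S = {v \<in> grid r c. S v = None}"

definition path_within :: "cell set \<Rightarrow> cell \<Rightarrow> cell \<Rightarrow> bool" where
  "path_within F u v \<longleftrightarrow>
     (\<exists>p. p \<noteq> [] \<and> hd p = u \<and> last p = v \<and> set p \<subseteq> F \<and> successively adjacent p)"

definition accessible :: "nat \<Rightarrow> nat \<Rightarrow> cell set \<Rightarrow> cell \<Rightarrow> bool" where
  "accessible r c F v \<longleftrightarrow> (\<exists>f \<in> front_row r c. path_within F f v)"

text \<open>A storage or relocation names the target cell; the path only has to exist.\<close>

datatype action =
    Store load cell
  | Retrieve load
  | is_Relocate: Relocate load cell

text \<open>In a retrieval or relocation the cell \<open>u\<close> of the moving load counts as free.\<close>

inductive step :: "nat \<Rightarrow> nat \<Rightarrow> config \<Rightarrow> action \<Rightarrow> config \<Rightarrow> bool" for r c where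
  store:
    "l \<notin> ran S \<Longrightarrow> v \<in> empty_cells r c S \<Longrightarrow>
     f \<in> front_row r c \<Longrightarrow> path_within (empty_cells r c S) f v \<Longrightarrow>
     step r c S (Store l v) (S(v \<mapsto> l))"
| retrieve:
    "u \<in> grid r c \<Longrightarrow> S u = Some l \<Longrightarrow>
     f \<in> front_row r c \<Longrightarrow> path_within (insert u (empty_cells r c S)) u f \<Longrightarrow>
     step r c S (Retrieve l) (S(u := None))"
| relocate:
    "u \<in> grid r c \<Longrightarrow> S u = Some l \<Longrightarrow> v \<in> empty_cells r c S \<Longrightarrow>
     path_within (insert u (empty_cells r c S)) u v \<Longrightarrow>
     accessible r c (insert u (empty_cells r c S)) u \<Longrightarrow>
     accessible r c (insert u (empty_cells r c S)) v \<Longrightarrow>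
     step r c S (Relocate l v) (S(u := None, v \<mapsto> l))"

inductive run :: "nat \<Rightarrow> nat \<Rightarrow> config \<Rightarrow> action list \<Rightarrow> config \<Rightarrow> bool" for r c where
  run_Nil: "run r c S [] S"
| run_Cons: "step r c S a S' \<Longrightarrow> run r c S' as S'' \<Longrightarrow> run r c S (a # as) S''"

fun stored_loads :: "action list \<Rightarrow> load list" where
  "stored_loads [] = []"
| "stored_loads (Store l v # as) = l # stored_loads as"
| "stored_loads (Retrieve l # as) = stored_loads as"
| "stored_loads (Relocate l v # as) = stored_loads as"

fun retrieved_loads :: "action list \<Rightarrow> load list" where
  "retrieved_loads [] = []"
| "retrieved_loads (Store l v # as) = retrieved_loads as"
| "retrieved_loads (Retrieve l # as) = l # retrieved_loads as"
| "retrieved_loads (Relocate l v # as) = retrieved_loads as"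

text \<open>Relocations may occur anywhere; all storages, in the order \<open>A\<close>, precede all retrievals, in the
  order \<open>D\<close>.\<close>

definition is_plan :: "nat \<Rightarrow> nat \<Rightarrow> load list \<Rightarrow> load list \<Rightarrow> action list \<Rightarrow> bool" where
  "is_plan r c A D as \<longleftrightarrow>
     (\<exists>S. run r c Map.empty as S) \<and>
     (\<exists>bs cs. as = bs @ cs \<and>
        stored_loads bs = A \<and> retrieved_loads bs = [] \<and>
        stored_loads cs = [] \<and> retrieved_loads cs = D)"

definition relocation_free :: "action list \<Rightarrow> bool" where
  "relocation_free as \<longleftrightarrow> (\<forall>a \<in> set as. \<not> is_Relocate a)"

end

theory Submission imports Defs
begin

text \<open>Take \<open>A = [1, 3, 2, 4]\<close>. Just before 4 is stored and just after it, the area has one and no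
  empty cell, so 4 (stored last) and 1 (retrieved first) occupy the two front cells, and 2 is in the
  back row. When 2 is stored, the only other empty cell is the future cell of 4, so 2 must be
  directly behind 4; when 2 is retrieved, the only other empty cell is the former cell of 1, so 2
  must be directly behind 1.\<close>

text \<open>An invariant argument: a path that starts in \<open>C\<close> cannot leave it, because
  each step lands in \<open>F\<close> and \<open>C\<close> is closed under such steps. Choosing a
  small \<open>C\<close> thus bounds what is reachable.\<close>

lemma path_within_closed:
  assumes "path_within F u v" "u \<in> C"
    and closed: "\<And>x y. x \<in> C \<Longrightarrow> y \<in> F \<Longrightarrow> adjacent x y \<Longrightarrow> y \<in> C"
  shows "v \<in> C"
proof -
  obtain p where p: "p \<noteq> []" "hd p = u" "last p = v" "set p \<subseteq> F" "successively adjacent p"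
    using assms(1) unfolding path_within_def by blast
  \<comment> \<open>The start is only required to lie in \<open>C\<close>, since the induction
    hypothesis is applied to a tail that begins at another cell.\<close>
  have "last p \<in> C" if "p \<noteq> []" "hd p \<in> C" "set p \<subseteq> F" "successively adjacent p" for p
    using that
  proof (induction p)
    case (Cons x p)
    then show ?case
      using closed by (cases p) auto
  qed simp
  then show ?thesis
    using p assms(2) by blast
qed

lemma path_within_start: "path_within F u v \<Longrightarrow> u \<in> F"
  unfolding path_within_def by (metis hd_in_set subsetD)

lemma path_within_singleton:
  assumes "path_within {w} u v"
  shows "u = w" "v = w"
  using path_within_start[OF assms] path_within_closed[OF assms, of "{w}"] by auto

lemma path_within_pair:
  assumes "path_within {u, w} u v"
  shows "v = u \<or> v = w \<and> adjacent u w"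
  \<comment> \<open>This closed set covers both cases: it contains \<open>w\<close> only if
    \<open>u\<close> and \<open>w\<close> are adjacent (or equal).\<close>
  using path_within_closed[OF assms, of "{x. x = u \<or> x = w \<and> adjacent u w}"] by auto

text \<open>Retrievals and relocations are both excluded, so the first action must be a storage.
  Repeated use determines the storing phase up to its target cells.\<close>

lemma storing_phase_Cons:
  assumes "relocation_free as" "retrieved_loads as = []" "stored_loads as = l # ls"
  obtains v as' where "as = Store l v # as'" "relocation_free as'" "retrieved_loads as' = []"
    "stored_loads as' = ls"
  using assms by (cases as rule: stored_loads.cases) (auto simp: relocation_free_def)

lemma storing_phase_Nil:
  assumes "relocation_free as" "retrieved_loads as = []" "stored_loads as = []"
  shows "as = []"
  using assms by (cases as rule: stored_loads.cases) (auto simp: relocation_free_def)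

lemma retrieving_phase_Cons:
  assumes "relocation_free as" "stored_loads as = []" "retrieved_loads as = l # ls"
  obtains as' where "as = Retrieve l # as'" "relocation_free as'" "stored_loads as' = []"
    "retrieved_loads as' = ls"
  using assms by (cases as rule: stored_loads.cases) (auto simp: relocation_free_def)

inductive_cases run_ConsE: "run r c S (a # as) T"
inductive_cases step_StoreE: "step r c S (Store l v) T"
inductive_cases step_RetrieveE: "step r c S (Retrieve l) T"

lemma no_relocation_free_plan_1324:
  assumes "is_plan 2 2 [1, 3, 2, 4] [1, 2, 3, 4] as" "relocation_free as"
  shows False
proof -
  obtain S bs cs where S: "run 2 2 Map.empty as S" and as: "as = bs @ cs"
    and bs: "stored_loads bs = [1, 3, 2, 4]" "retrieved_loads bs = []"
    and cs: "stored_loads cs = []" "retrieved_loads cs = [1, 2, 3, 4]"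
    using assms(1) unfolding is_plan_def by blast
  have rf: "relocation_free bs" "relocation_free cs"
    using assms(2) by (auto simp: as relocation_free_def)
  obtain v1 v3 v2 v4 where bs_eq: "bs = [Store 1 v1, Store 3 v3, Store 2 v2, Store 4 v4]"
    using rf(1) bs by (metis storing_phase_Cons storing_phase_Nil)
  obtain cs' where cs_eq: "cs = Retrieve 1 # Retrieve 2 # cs'"
    using rf(2) cs by (metis retrieving_phase_Cons)
  \<comment> \<open>Cells \<open>v1\<close>, ..., \<open>v4\<close> are indexed by load label, the
    configurations by the number of loads stored.\<close>
  define S2 :: config where "S2 = [v1 \<mapsto> 1, v3 \<mapsto> 3]"
  define S3 where "S3 = S2(v2 \<mapsto> 2)"
  define S4 where "S4 = S3(v4 \<mapsto> 4)"
  obtain T1 T2 T3 T4 T T' where run_steps: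
    "step 2 2 Map.empty (Store 1 v1) T1" "step 2 2 T1 (Store 3 v3) T2"
    "step 2 2 T2 (Store 2 v2) T3" "step 2 2 T3 (Store 4 v4) T4"
    "step 2 2 T4 (Retrieve 1) T" "step 2 2 T (Retrieve 2) T'"
    using S unfolding as bs_eq cs_eq append_Cons append_Nil by (elim run_ConsE) blast
  have "T1 = [v1 \<mapsto> 1]" "T2 = S2" "T3 = S3" "T4 = S4"
    using run_steps(1-4) unfolding S2_def S3_def S4_def by (auto elim!: step_StoreE)
  with run_steps have steps:
    "step 2 2 Map.empty (Store 1 v1) [v1 \<mapsto> 1]"
    "step 2 2 [v1 \<mapsto> 1] (Store 3 v3) S2"
    "step 2 2 S2 (Store 2 v2) S3"
    "step 2 2 S3 (Store 4 v4) S4"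
    "step 2 2 S4 (Retrieve 1) T"
    "step 2 2 T (Retrieve 2) T'"
    by simp_all
  have in_grid: "{v1, v2, v3, v4} \<subseteq> grid 2 2" and dist: "distinct [v1, v3, v2, v4]"
    using steps(1-4) unfolding S2_def S3_def
    by (auto elim!: step_StoreE simp: empty_cells_def split: if_splits)
  \<comment> \<open>Four distinct target cells exhaust the grid, so every later set of empty cells
    can be written in terms of them.\<close>
  have grid: "grid 2 2 = {v1, v2, v3, v4}"
  proof (rule sym, rule card_subset_eq[OF _ in_grid])
    show "card {v1, v2, v3, v4} = card (grid 2 2)"
      using dist by (auto simp: grid_def)
  qed (simp add: grid_def)
  have empty: "empty_cells 2 2 S2 = {v2, v4}" "empty_cells 2 2 S3 = {v4}" "empty_cells 2 2 S4 = {}"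
    using dist by (auto simp: empty_cells_def grid S2_def S3_def S4_def)
  have v4: "v4 \<in> front_row 2 2"
    using steps(4) by (auto elim!: step_StoreE simp: empty dest: path_within_singleton)
  \<comment> \<open>The area is full, so load 1 has no cell to move through and must already be in
    front.\<close>
  obtain u f where u: "S4 u = Some 1" "T = S4(u := None)" "u \<in> grid 2 2"
      "f \<in> front_row 2 2" "path_within {u} u f"
    using steps(5) by (auto elim!: step_RetrieveE simp: empty)
  have [simp]: "u = v1"
    using u(1) dist by (auto simp: S2_def S3_def S4_def split: if_splits)
  have v1: "v1 \<in> front_row 2 2"
    using u(4) path_within_singleton[OF u(5)] by simp
  \<comment> \<open>The front row has only two cells, taken by \<open>v1\<close> and
    \<open>v4\<close>.\<close>
  have v2: "v2 \<notin> front_row 2 2"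
    using v1 v4 dist by (auto simp: front_row_def grid_def less_2_cases_iff)
  have "empty_cells 2 2 T = {v1}"
    using u(2) dist by (auto simp: empty_cells_def grid S2_def S3_def S4_def)
  moreover have "T x = Some 2 \<Longrightarrow> x = v2" for x
    using u(2) by (auto simp: S2_def S3_def S4_def split: if_splits)
  ultimately obtain g where "g \<in> front_row 2 2" "path_within {v2, v1} v2 g"
    using steps(6) by (auto elim!: step_RetrieveE)
  \<comment> \<open>As \<open>g\<close> is in front and \<open>v2\<close> is not, the path must
    leave \<open>v2\<close>, and only \<open>v1\<close> is free.\<close>
  then have "adjacent v2 v1"
    using path_within_pair v2 by blast
  moreover obtain h where h: "h \<in> front_row 2 2" "path_within {v2, v4} h v2"
    using steps(3) by (auto elim!: step_StoreE simp: empty)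
  then have "h = v4"
    using path_within_start v2 by blast
  then have "adjacent v4 v2"
    using h path_within_pair[of v4 v2 v2] dist by (auto simp: insert_commute)
  \<comment> \<open>Being in the back row, \<open>v2\<close> can be adjacent to a front cell only
    within its own column, which forces \<open>v1 = v4\<close>.\<close>
  ultimately show False
    using v1 v2 v4 in_grid dist unfolding adjacent_def front_row_def
    by (auto simp: prod_eq_iff)
qed

theorem mainTheorem8:
  "\<exists>(n::nat) (A::load list). n \<le> 4 \<and> distinct A \<and> set A = {1..n} \<and>
     \<not> (\<exists>as. is_plan 2 2 A [1..<Suc n] as \<and> relocation_free as)"
proof (intro exI[of _ 4] exI[of _ "[1, 3, 2, 4]"] conjI)
  show "set [1, 3, 2, 4] = {1..4::nat}"
    by auto
  have "[1..<Suc 4] = [1, 2, 3, 4]"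
    by (simp add: upt_rec)
  then show "\<not> (\<exists>as. is_plan 2 2 [1, 3, 2, 4] [1..<Suc 4] as \<and> relocation_free as)"
    using no_relocation_free_plan_1324 by metis
qed auto

end
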